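(* Let $p$ be an odd prime and $P$ a finite abelian $p$-group of type $e \in E(n)$ (where $n \geq 1$). Then $$\mathrm{Spec}_R(P) = \{p^{i} \mid i \in \{0, \ldots, \Sigma(e)\}\}.$$
   Context: Reidemeister spectrum: for a group $G$ and an endomorphism $\varphi$ of $G$, elements $x,y\in G$ are $\varphi$-conjugate if there is $z \in G$ with $x = z y \varphi(z)^{-1}$. The Reidemeister number $R(\varphi)$ is the number of $\varphi$-conjugacy classes, and $\mathrm{Spec}_R(G) = \{R(\psi) \mid \psi \in \mathrm{Aut}(G)\}$. Types: for an integer $n \geq 1$, $E(n)$ is the set of $e=(e_1,\ldots,e_n)\in\mathbb{Z}^n$ with $1 \leq e_1 \leq e_2 \leq \cdots \leq e_n$. For a prime $p$, a finite abelian $p$-group is of type $e \in E(n)$ if it is isomorphic to $\bigoplus_{i=1}^n \mathbb{Z}/p^{e_i}\mathbb{Z}$. Put $\Sigma(e) = \sum_{i=1}^n e_i$. *)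

theory Defs
  imports "HOL-Algebra.Bij" "HOL-Algebra.Product_Groups"
    "HOL-Computational_Algebra.Primes" "HOL-Library.Extended_Nat"
begin

definition twisted_conj ::
    "('a, 'b) monoid_scheme \<Rightarrow> ('a \<Rightarrow> 'a) \<Rightarrow> ('a \<times> 'a) set" where
  "twisted_conj G \<phi> =
     {(x, y). x \<in> carrier G \<and> y \<in> carrier G \<and>
              (\<exists>z \<in> carrier G. x = z \<otimes>\<^bsub>G\<^esub> y \<otimes>\<^bsub>G\<^esub> inv\<^bsub>G\<^esub> (\<phi> z))}"

(* A value in enat, since on an infinite group there may be infinitely many classes,
   in which case card would return 0. *)
definition reidemeister_number ::
    "('a, 'b) monoid_scheme \<Rightarrow> ('a \<Rightarrow> 'a) \<Rightarrow> enat" where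
  "reidemeister_number G \<phi> =
     (if finite (carrier G // twisted_conj G \<phi>)
      then enat (card (carrier G // twisted_conj G \<phi>)) else \<infinity>)"

definition reidemeister_spectrum :: "('a, 'b) monoid_scheme \<Rightarrow> enat set" where
  "reidemeister_spectrum G = reidemeister_number G ` auto G"

(* The entries are at least 1, so tuples in Z^n are represented by lists over nat. *)
definition type_tuples :: "nat \<Rightarrow> nat list set" where
  "type_tuples n = {e. length e = n \<and> sorted e \<and> (\<forall>k \<in> set e. 1 \<le> k)}"

definition finite_abelian_p_group :: "nat \<Rightarrow> ('a, 'b) monoid_scheme \<Rightarrow> bool" where
  "finite_abelian_p_group p G \<longleftrightarrow>
     comm_group G \<and> finite (carrier G) \<and> (\<exists>k. order G = p ^ k)"

definition of_type :: "nat \<Rightarrow> nat list \<Rightarrow> ('a, 'b) monoid_scheme \<Rightarrow> bool" where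
  "of_type p e G \<longleftrightarrow>
     G \<cong> sum_group {..<length e} (\<lambda>i. integer_mod_group (p ^ (e ! i)))"

end

theory Submission
  imports Defs
begin

text \<open>
  On an abelian group \<open>G\<close> two elements are \<open>\<phi>\<close>-conjugate exactly when they differ by an element
  of the image of \<open>\<tau> z = z (\<phi> z)\<^bsup>-1\<^esup>\<close>. This \<open>\<tau>\<close> is an endomorphism whose kernel is the set of fixed
  points of \<open>\<phi>\<close>, so for finite \<open>G\<close> the number of classes, which is the index of the image of \<open>\<tau>\<close>,
  equals the number of fixed points of \<open>\<phi>\<close>
  (\<open>reidemeister_number_eq_card_fixed_points\<close>). The fixed points form a subgroup, so when
  \<open>G\<close> has order \<open>p\<^bsup>\<Sigma>(e)\<^esup>\<close>, every Reidemeister number is a power \<open>p\<^bsup>i\<^esup>\<close> with \<open>i \<le> \<Sigma>(e)\<close>.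

  All these powers occur. On a cyclic group of order \<open>p\<^bsup>k\<^esup>\<close>, multiplication by \<open>1 + p\<^bsup>j\<^esup>\<close> with
  \<open>j \<le> k\<close> fixes exactly the solutions of \<open>p\<^bsup>j\<^esup> x = 0\<close>, of which there are \<open>p\<^bsup>j\<^esup>\<close>
  (\<open>cyclic_prime_power_iso_fixed_points\<close>). It is an automorphism for every \<open>j\<close>: for
  \<open>j \<ge> 1\<close> the multiplier is \<open>1\<close> modulo \<open>p\<close>, and for \<open>j = 0\<close> it is \<open>2\<close>, a unit because \<open>p\<close> is
  odd. Given \<open>i \<le> \<Sigma>(e)\<close>, choose \<open>j\<^sub>k \<le> e\<^sub>k\<close> with sum \<open>i\<close>; as fixed points of a product of
  automorphisms multiply (\<open>sum_group_auto\<close>), the product of the corresponding multiplications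
  has \<open>p\<^bsup>i\<^esup>\<close> fixed points.
\<close>

definition fixed_points :: "('a, 'b) monoid_scheme \<Rightarrow> ('a \<Rightarrow> 'a) \<Rightarrow> 'a set" where
  "fixed_points G \<phi> = {x \<in> carrier G. \<phi> x = x}"

section \<open>Reidemeister numbers of finite abelian groups\<close>

text \<open>
  The first isomorphism theorem identifies the cosets of the kernel with the image; Lagrange's
  theorem then counts the elements of the group by cosets.
\<close>

lemma (in group_hom) card_kernel_times_card_image:
  "card (kernel G H h) * card (h ` carrier G) = order G"
proof -
  let ?I = "H\<lparr>carrier := h ` carrier G\<rparr>"
  have "subgroup (h ` carrier G) H"
    by (rule img_is_subgroup)
  then interpret I: group ?I
    using H.subgroup_imp_group by blast
  interpret hI: group_hom G ?I h
    by unfold_locales (auto simp: hom_def)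
  have ker: "kernel G ?I h = kernel G H h"
    by (simp add: kernel_def)
  have "G Mod kernel G H h \<cong> ?I"
    using hI.FactGroup_iso ker by simp
  then have "card (rcosets (kernel G H h)) = card (h ` carrier G)"
    using iso_same_card by (fastforce simp: FactGroup_def)
  then show ?thesis
    using G.lagrange [OF subgroup_kernel] by (simp add: mult.commute)
qed

text \<open>
  By commutativity \<open>x = z y (\<phi> z)\<^bsup>-1\<^esup>\<close> can be rewritten as \<open>x = \<tau> z y\<close> with
  \<open>\<tau> z = z (\<phi> z)\<^bsup>-1\<^esup>\<close>, which says that \<open>x\<close> and \<open>y\<close> lie in the same coset of the image of \<open>\<tau>\<close>.
\<close>

lemma (in comm_group) quotient_twisted_conj_eq_rcosets:
  assumes "\<phi> \<in> hom G G"
  shows "carrier G // twisted_conj G \<phi> = rcosets ((\<lambda>z. z \<otimes> inv (\<phi> z)) ` carrier G)"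
proof -
  let ?\<tau> = "\<lambda>z. z \<otimes> inv (\<phi> z)"
  interpret \<phi>: group_hom G G \<phi>
    using assms by unfold_locales
  have swap: "(a \<otimes> b) \<otimes> (c \<otimes> y \<otimes> d) = (a \<otimes> c) \<otimes> (b \<otimes> d) \<otimes> y"
    if "a \<in> carrier G" "b \<in> carrier G" "c \<in> carrier G" "d \<in> carrier G" "y \<in> carrier G" for a b c d y
    using that by (simp add: m_ac)
  have coset: "twisted_conj G \<phi> `` {x} = (?\<tau> ` carrier G) #> x" if x: "x \<in> carrier G" for x
  proof (intro equalityI subsetI)
    fix y assume "y \<in> twisted_conj G \<phi> `` {x}"
    then obtain z where z: "z \<in> carrier G" "y \<in> carrier G" "x = z \<otimes> y \<otimes> inv (\<phi> z)"
      by (auto simp: twisted_conj_def)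
    have "?\<tau> (inv z) \<otimes> x = (inv z \<otimes> \<phi> z) \<otimes> (z \<otimes> y \<otimes> inv (\<phi> z))"
      using z by simp
    also have "\<dots> = (inv z \<otimes> z) \<otimes> (\<phi> z \<otimes> inv (\<phi> z)) \<otimes> y"
      using z by (intro swap) simp_all
    finally have "y = ?\<tau> (inv z) \<otimes> x"
      using z by simp
    moreover have "?\<tau> (inv z) \<in> ?\<tau> ` carrier G"
      using z(1) inv_closed by (intro imageI)
    ultimately show "y \<in> (?\<tau> ` carrier G) #> x"
      unfolding r_coset_def by blast
  next
    fix y assume "y \<in> (?\<tau> ` carrier G) #> x"
    then obtain z where z: "z \<in> carrier G" "y = ?\<tau> z \<otimes> x"
      by (auto simp: r_coset_def)
    have "inv z \<otimes> y \<otimes> inv (\<phi> (inv z)) = (inv z \<otimes> \<phi> z) \<otimes> (z \<otimes> x \<otimes> inv (\<phi> z))"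
      using z x by (simp add: m_ac)
    also have "\<dots> = (inv z \<otimes> z) \<otimes> (\<phi> z \<otimes> inv (\<phi> z)) \<otimes> x"
      using z x by (intro swap) simp_all
    finally have "inv z \<otimes> y \<otimes> inv (\<phi> (inv z)) = (inv z \<otimes> z) \<otimes> (\<phi> z \<otimes> inv (\<phi> z)) \<otimes> x" .
    then have "x = inv z \<otimes> y \<otimes> inv (\<phi> (inv z))"
      using z x by simp
    moreover have "y \<in> carrier G" using z x by simp
    ultimately show "y \<in> twisted_conj G \<phi> `` {x}"
      using z(1) x unfolding twisted_conj_def by blast
  qed
  then show ?thesis
    by (auto simp: quotient_def RCOSETS_def)
qed

lemma (in comm_group) displacement_hom:
  assumes "\<phi> \<in> hom G G"
  shows "(\<lambda>z. z \<otimes> inv (\<phi> z)) \<in> hom G G"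
proof -
  interpret \<phi>: group_hom G G \<phi>
    using assms by unfold_locales
  show ?thesis
    by (rule homI) (simp_all add: inv_mult m_ac)
qed

lemma (in comm_group) kernel_displacement:
  assumes "\<phi> \<in> hom G G"
  shows "kernel G G (\<lambda>z. z \<otimes> inv (\<phi> z)) = fixed_points G \<phi>"
proof -
  interpret \<phi>: group_hom G G \<phi>
    using assms by unfold_locales
  have "z \<otimes> inv (\<phi> z) = \<one> \<longleftrightarrow> \<phi> z = z" if "z \<in> carrier G" for z
    using that by (metis inv_solve_right' one_closed l_one \<phi>.hom_closed)
  then show ?thesis
    by (auto simp: kernel_def fixed_points_def)
qed

text \<open>
  The cokernel and the kernel of an endomorphism of a finite group have the same number of
  elements, since both numbers multiply with the order of the image to the order of the group.
\<close>

lemma (in comm_group) reidemeister_number_eq_card_fixed_points: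
  assumes fin: "finite (carrier G)" and \<phi>: "\<phi> \<in> hom G G"
  shows "reidemeister_number G \<phi> = enat (card (fixed_points G \<phi>))"
proof -
  let ?\<tau> = "\<lambda>z. z \<otimes> inv (\<phi> z)"
  interpret \<tau>: group_hom G G ?\<tau>
    using displacement_hom [OF \<phi>] by unfold_locales
  have sub: "subgroup (?\<tau> ` carrier G) G"
    by (rule \<tau>.img_is_subgroup)
  have "card (rcosets (?\<tau> ` carrier G)) * card (?\<tau> ` carrier G)
      = card (fixed_points G \<phi>) * card (?\<tau> ` carrier G)"
    using lagrange [OF sub] \<tau>.card_kernel_times_card_image kernel_displacement [OF \<phi>] by simp
  moreover have "card (?\<tau> ` carrier G) \<noteq> 0"
    using fin by (auto simp: card_eq_0_iff)
  ultimately have "card (rcosets (?\<tau> ` carrier G)) = card (fixed_points G \<phi>)"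
    by simp
  moreover have "finite (rcosets (?\<tau> ` carrier G))"
    using fin by (simp add: RCOSETS_def)
  ultimately show ?thesis
    by (simp add: reidemeister_number_def quotient_twisted_conj_eq_rcosets [OF \<phi>])
qed

lemma (in comm_group) card_fixed_points_dvd_order:
  assumes "\<phi> \<in> hom G G"
  shows "card (fixed_points G \<phi>) dvd order G"
proof -
  interpret \<tau>: group_hom G G "\<lambda>z. z \<otimes> inv (\<phi> z)"
    using displacement_hom [OF assms] by unfold_locales
  show ?thesis
    using \<tau>.card_kernel_times_card_image kernel_displacement [OF assms]
    by (metis dvd_triv_left)
qed

section \<open>Transport and products of automorphisms\<close>

lemma auto_eq_extensional_iso: "auto G = iso G G \<inter> extensional (carrier G)"
  by (auto simp: auto_def Bij_def iso_def)

text \<open>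
  The elements of \<^const>\<open>auto\<close> are extensional functions, so an isomorphism given by a formula has
  to be cut down to the carrier first.
\<close>

lemma (in group) restrict_iso_in_auto:
  assumes "f \<in> iso G G"
  shows "restrict f (carrier G) \<in> auto G"
proof -
  have "restrict f (carrier G) \<in> hom G G"
    using assms by (auto simp: iso_def hom_def Pi_iff)
  moreover have "bij_betw (restrict f (carrier G)) (carrier G) (carrier G)"
    using assms by (simp add: iso_def cong: bij_betw_cong)
  ultimately show ?thesis
    by (auto simp: auto_def Bij_def)
qed

text \<open>
  Conjugating \<open>\<psi>\<close> by the isomorphism \<open>h\<close> gives the automorphism of \<open>G\<close>, and \<open>h\<close> then
  restricts to a bijection between the two sets of fixed points.
\<close>

lemma (in group) auto_transport:
  assumes h: "h \<in> iso G H" and \<psi>: "\<psi> \<in> auto H"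
  obtains \<phi> where "\<phi> \<in> auto G" "card (fixed_points G \<phi>) = card (fixed_points H \<psi>)"
proof -
  let ?g = "inv_into (carrier G) h"
  let ?\<phi> = "restrict (?g \<circ> (\<psi> \<circ> h)) (carrier G)"
  have "\<psi> \<in> iso H H"
    using \<psi> by (simp add: auto_eq_extensional_iso)
  then have "?g \<circ> (\<psi> \<circ> h) \<in> iso G G"
    using h iso_set_sym [OF h] by (intro iso_set_trans)
  then have "?\<phi> \<in> auto G"
    by (rule restrict_iso_in_auto)
  moreover have "bij_betw h (fixed_points G ?\<phi>) (fixed_points H \<psi>)"
  proof -
    have bij: "bij_betw h (carrier G) (carrier H)"
      using h by (simp add: iso_def)
    have cl: "\<psi> y \<in> carrier H" if "y \<in> carrier H" for y
      using \<psi> that by (auto simp: auto_def hom_def)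
    have "?g (\<psi> (h x)) = x \<longleftrightarrow> \<psi> (h x) = h x" if "x \<in> carrier G" for x
      using bij cl that
      by (metis bij_betwE bij_betw_inv_into_left bij_betw_inv_into_right)
    then have "h ` fixed_points G ?\<phi> = fixed_points H \<psi>"
      using bij by (auto simp: fixed_points_def bij_betw_def)
    moreover have "fixed_points G ?\<phi> \<subseteq> carrier G"
      by (auto simp: fixed_points_def)
    ultimately show ?thesis
      using bij by (metis bij_betw_subset)
  qed
  ultimately show thesis
    using that bij_betw_same_card by blast
qed

lemma carrier_sum_group_finite:
  assumes "finite I" and "\<And>i. i \<in> I \<Longrightarrow> group (G i)"
  shows "carrier (sum_group I G) = (\<Pi>\<^sub>E i\<in>I. carrier (G i))"
  using assms by (auto simp: carrier_sum_group)

text \<open>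
  The automorphism acts by \<open>f i\<close> in the \<open>i\<close>-th coordinate, so a tuple is fixed exactly when each
  of its entries is.
\<close>

lemma sum_group_auto:
  assumes I: "finite I" and G: "\<And>i. i \<in> I \<Longrightarrow> group (G i)"
    and f: "\<And>i. i \<in> I \<Longrightarrow> f i \<in> iso (G i) (G i)"
  obtains \<psi> where "\<psi> \<in> auto (sum_group I G)"
    "card (fixed_points (sum_group I G) \<psi>) = (\<Prod>i\<in>I. card (fixed_points (G i) (f i)))"
proof -
  let ?S = "sum_group I G"
  let ?h = "\<lambda>x. \<lambda>i\<in>I. f i (x i)"
  have car: "carrier ?S = (\<Pi>\<^sub>E i\<in>I. carrier (G i))"
    using I G by (rule carrier_sum_group_finite)
  have bij: "bij_betw (f i) (carrier (G i)) (carrier (G i))" if "i \<in> I" for i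
    using f [OF that] by (simp add: iso_def)
  have cl: "f i x \<in> carrier (G i)" if "i \<in> I" "x \<in> carrier (G i)" for i x
    using bij_betw_apply [OF bij] that by blast
  have hom: "f i (x \<otimes>\<^bsub>G i\<^esub> y) = f i x \<otimes>\<^bsub>G i\<^esub> f i y"
    if "i \<in> I" "x \<in> carrier (G i)" "y \<in> carrier (G i)" for i x y
    using f [OF that(1)] that by (auto simp: iso_def hom_def)
  interpret S: group ?S
    using G by simp
  have hom_h: "?h \<in> hom ?S ?S"
  proof (rule homI)
    show "?h x \<in> carrier ?S" if "x \<in> carrier ?S" for x
      using that unfolding car by (auto simp only: restrict_PiE_iff intro!: cl dest: PiE_mem)
    show "?h (x \<otimes>\<^bsub>?S\<^esub> y) = ?h x \<otimes>\<^bsub>?S\<^esub> ?h y" if xy: "x \<in> carrier ?S" "y \<in> carrier ?S" for x y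
    proof (rule extensionalityI)
      show "?h (x \<otimes>\<^bsub>?S\<^esub> y) i = (?h x \<otimes>\<^bsub>?S\<^esub> ?h y) i" if i: "i \<in> I" for i
        using hom [OF i] PiE_mem [OF xy(1) [unfolded car] i] PiE_mem [OF xy(2) [unfolded car] i] i
        by simp
    qed simp_all
  qed
  have inj_h: "inj_on ?h (carrier ?S)"
  proof (rule inj_onI)
    fix x y assume x: "x \<in> carrier ?S" and y: "y \<in> carrier ?S" and eq: "?h x = ?h y"
    show "x = y"
    proof (rule PiE_ext)
      fix i assume i: "i \<in> I"
      have "f i (x i) = f i (y i)"
        using fun_cong [OF eq, of i] i by simp
      then show "x i = y i"
        using inj_onD [OF bij_betw_imp_inj_on [OF bij [OF i]]] PiE_mem [OF x [unfolded car] i]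
          PiE_mem [OF y [unfolded car] i] by blast
    qed (use x y in \<open>simp_all only: car\<close>)
  qed
  have surj_h: "carrier ?S \<subseteq> ?h ` carrier ?S"
  proof
    fix y assume y: "y \<in> carrier ?S"
    let ?x = "\<lambda>i\<in>I. inv_into (carrier (G i)) (f i) (y i)"
    have "?x \<in> carrier ?S"
      unfolding car restrict_PiE_iff
      using bij_betw_apply [OF bij_betw_inv_into [OF bij]] PiE_mem [OF y [unfolded car]] by blast
    moreover have "y = ?h ?x"
    proof (rule extensionalityI)
      show "y \<in> extensional I"
        using y by (simp add: car PiE_iff)
      show "y i = ?h ?x i" if "i \<in> I" for i
        using y that bij_betw_inv_into_right [OF bij [OF that], of "y i"] by (simp add: car PiE_iff)
    qed simp
    ultimately show "y \<in> ?h ` carrier ?S"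
      by (intro image_eqI [of _ ?h ?x])
  qed
  have "?h ` carrier ?S = carrier ?S"
    using hom_carrier [OF hom_h] surj_h by (rule equalityI)
  then have "?h \<in> iso ?S ?S"
    using hom_h inj_h unfolding iso_def bij_betw_def by blast
  then have aut: "restrict ?h (carrier ?S) \<in> auto ?S"
    by (rule S.restrict_iso_in_auto)
  have fixed: "?h x = x \<longleftrightarrow> (\<forall>i\<in>I. f i (x i) = x i)" if "x \<in> carrier ?S" for x
  proof -
    have "x \<in> extensional I"
      using that by (simp add: car PiE_iff)
    then show ?thesis
      using extensional_arb [of x I] by (auto simp: fun_eq_iff restrict_apply)
  qed
  have "fixed_points ?S (restrict ?h (carrier ?S)) = {x \<in> carrier ?S. ?h x = x}"
    by (simp add: fixed_points_def cong: conj_cong)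
  also have "\<dots> = {x \<in> carrier ?S. \<forall>i\<in>I. f i (x i) = x i}"
    using fixed by blast
  also have "\<dots> = (\<Pi>\<^sub>E i\<in>I. fixed_points (G i) (f i))"
    unfolding car fixed_points_def PiE_def Pi_def by blast
  finally have "fixed_points ?S (restrict ?h (carrier ?S)) = (\<Pi>\<^sub>E i\<in>I. fixed_points (G i) (f i))" .
  then have "card (fixed_points ?S (restrict ?h (carrier ?S)))
      = (\<Prod>i\<in>I. card (fixed_points (G i) (f i)))"
    using I by (simp add: card_PiE)
  with aut show thesis
    by (rule that)
qed

section \<open>Multiplications on cyclic groups\<close>

lemma integer_mod_group_mult_iso:
  assumes n: "n > 0" and "coprime u (int n)"
  shows "(\<lambda>x. (u * x) mod int n) \<in> iso (integer_mod_group n) (integer_mod_group n)"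
proof -
  let ?f = "\<lambda>x. (u * x) mod int n"
  have car: "carrier (integer_mod_group n) = {0..<int n}"
    using n by (simp add: carrier_integer_mod_group)
  have "?f \<in> hom (integer_mod_group n) (integer_mod_group n)"
    using n by (intro homI) (auto simp: car mod_simps distrib_left)
  moreover have "inj_on ?f {0..<int n}"
  proof (rule inj_onI)
    fix x y assume xy: "x \<in> {0..<int n}" "y \<in> {0..<int n}" "?f x = ?f y"
    then have "int n dvd u * (x - y)"
      by (simp add: mod_eq_dvd_iff right_diff_distrib)
    then have "int n dvd x - y"
      using assms(2) by (simp add: coprime_dvd_mult_right_iff coprime_commute)
    then show "x = y"
      using xy by (metis mod_eq_dvd_iff mod_pos_pos_trivial atLeastLessThan_iff)
  qed
  moreover have "?f ` {0..<int n} \<subseteq> {0..<int n}"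
    using n by auto
  ultimately show ?thesis
    by (simp add: iso_def car bij_betw_def endo_inj_surj)
qed

text \<open>
  The fixed points of multiplication by \<open>1 + d\<close> are the elements annihilated by \<open>d\<close>, that is, the
  multiples of \<open>m\<close>.
\<close>

lemma card_fixed_points_integer_mod_group_mult:
  assumes "d > 0" "m > 0"
  shows "card (fixed_points (integer_mod_group (d * m)) (\<lambda>x. ((1 + int d) * x) mod int (d * m))) = d"
    (is "card ?F = d")
proof -
  have "?F = {x \<in> {0..<int (d * m)}. int m dvd x}"
  proof -
    have "((1 + int d) * x) mod int (d * m) = x \<longleftrightarrow> int m dvd x" if "x \<in> {0..<int (d * m)}" for x
    proof -
      have "((1 + int d) * x) mod int (d * m) = x \<longleftrightarrow>
          ((1 + int d) * x) mod int (d * m) = x mod int (d * m)"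
        using that by simp
      also have "\<dots> \<longleftrightarrow> int d * int m dvd int d * x"
        by (simp add: mod_eq_dvd_iff distrib_right)
      finally show ?thesis
        using assms by simp
    qed
    then show ?thesis
      using assms by (auto simp: fixed_points_def carrier_integer_mod_group)
  qed
  also have "\<dots> = (\<lambda>k. int m * k) ` {0..<int d}"
    using assms by (auto simp: dvd_def mult.commute zero_le_mult_iff)
  finally show ?thesis
    using assms by (simp add: card_image inj_on_def)
qed

text \<open>
  The witness is multiplication by \<open>1 + p\<^bsup>j\<^esup>\<close>. Oddness of \<open>p\<close> enters only for \<open>j = 0\<close>, where the
  multiplier is \<open>2\<close>; the cyclic group of order \<open>2\<close> indeed has no automorphism
  with a single fixed point.
\<close>

lemma cyclic_prime_power_iso_fixed_points:
  fixes p :: nat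
  assumes p: "Factorial_Ring.prime p" "odd p" and "j \<le> k"
  obtains f where "f \<in> iso (integer_mod_group (p ^ k)) (integer_mod_group (p ^ k))"
    "card (fixed_points (integer_mod_group (p ^ k)) f) = p ^ j"
proof -
  have "\<not> p dvd 1 + p ^ j"
  proof (cases j)
    case 0
    have "\<not> p dvd 2"
      using primes_dvd_imp_eq [OF p(1) two_is_prime_nat] p(2) by auto
    then show ?thesis
      using 0 by (metis power_0 one_add_one)
  next
    case (Suc i)
    then show ?thesis
      using p(1) by (metis dvd_add_left_iff dvd_power not_prime_unit zero_less_Suc)
  qed
  then have "coprime (1 + p ^ j) (p ^ k)"
    using p(1) by (metis coprime_commute coprime_power_right_iff prime_imp_coprime)
  then have "coprime (1 + int (p ^ j)) (int (p ^ k))"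
    by (metis coprime_int_iff of_nat_1 of_nat_add)
  then have "(\<lambda>x. ((1 + int (p ^ j)) * x) mod int (p ^ k))
      \<in> iso (integer_mod_group (p ^ k)) (integer_mod_group (p ^ k))"
    using p(1) by (intro integer_mod_group_mult_iso) (simp_all add: prime_gt_0_nat)
  moreover have "p ^ k = p ^ j * p ^ (k - j)"
    using \<open>j \<le> k\<close> by (simp flip: power_add)
  then have "card (fixed_points (integer_mod_group (p ^ k))
      (\<lambda>x. ((1 + int (p ^ j)) * x) mod int (p ^ k))) = p ^ j"
    using p(1) card_fixed_points_integer_mod_group_mult [of "p ^ j" "p ^ (k - j)"]
    by (simp add: prime_gt_0_nat)
  ultimately show thesis
    by (rule that)
qed

section \<open>The spectrum\<close>

lemma sum_bounded_decomposition:
  fixes e :: "'i \<Rightarrow> nat"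
  assumes "finite I" and "m \<le> sum e I"
  obtains j where "\<And>i. i \<in> I \<Longrightarrow> j i \<le> e i" "sum j I = m"
proof -
  have "\<exists>j. (\<forall>i\<in>I. j i \<le> e i) \<and> sum j I = m"
    using assms
  proof (induction I arbitrary: m rule: finite_induct)
    case (insert a I)
    \<comment> \<open>Greedy choice: \<open>a\<close> takes as much of \<open>m\<close> as it can, and the other indices share the rest.\<close>
    have "m - min m (e a) \<le> sum e I"
      using insert by simp
    then obtain j where j: "\<forall>i\<in>I. j i \<le> e i" "sum j I = m - min m (e a)"
      using insert.IH by blast
    have "sum (j(a := min m (e a))) I = sum j I"
      using insert.hyps by (intro sum.cong) auto
    then show ?case
      using insert.hyps j by (intro exI [of _ "j(a := min m (e a))"]) auto
  qed simp
  with that show thesis by blast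
qed

theorem proposition3p2:
  fixes p n :: nat
    and e :: "nat list"
    and P :: "('a, 'b) monoid_scheme"
  assumes "Factorial_Ring.prime p" and "odd p"
    and "n \<ge> 1" and "e \<in> type_tuples n"
    and "finite_abelian_p_group p P" and "of_type p e P"
  shows "reidemeister_spectrum P = {enat (p ^ i) | i. i \<in> {0..sum_list e}}"
proof -
  interpret P: comm_group P
    using assms by (simp add: finite_abelian_p_group_def)
  have fin: "finite (carrier P)"
    using assms by (simp add: finite_abelian_p_group_def)
  let ?I = "{..<length e}" and ?Z = "\<lambda>i. integer_mod_group (p ^ (e ! i))"
  let ?S = "sum_group ?I ?Z"
  obtain h where h: "h \<in> iso P ?S"
    using assms by (auto simp: of_type_def is_iso_def)
  have sum_e: "sum_list e = (\<Sum>i\<in>?I. e ! i)"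
    by (simp add: sum_list_sum_nth atLeast0LessThan)
  have "order P = card (\<Pi>\<^sub>E i\<in>?I. carrier (?Z i))"
    using iso_same_order [OF h] by (simp add: order_def carrier_sum_group_finite)
  also have "\<dots> = p ^ sum_list e"
    using assms(1) by (simp add: card_PiE carrier_integer_mod_group prime_gt_0_nat sum_e power_sum nat_power_eq)
  finally have order: "order P = p ^ sum_list e" .
  have R: "reidemeister_number P \<phi> = enat (card (fixed_points P \<phi>))" if "\<phi> \<in> auto P" for \<phi>
    using that P.reidemeister_number_eq_card_fixed_points [OF fin] by (simp add: auto_def)
  show ?thesis
  proof (intro equalityI subsetI)
    fix r assume "r \<in> reidemeister_spectrum P"
    then obtain \<phi> where \<phi>: "\<phi> \<in> auto P" "r = enat (card (fixed_points P \<phi>))"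
      using R by (auto simp: reidemeister_spectrum_def)
    have "card (fixed_points P \<phi>) dvd p ^ sum_list e"
      using \<phi>(1) P.card_fixed_points_dvd_order order by (simp add: auto_def)
    then show "r \<in> {enat (p ^ i) | i. i \<in> {0..sum_list e}}"
      using \<phi>(2) assms(1) by (auto simp: divides_primepow_nat)
  next
    fix r assume "r \<in> {enat (p ^ i) | i. i \<in> {0..sum_list e}}"
    then obtain m where m: "m \<le> sum_list e" "r = enat (p ^ m)"
      by auto
    obtain j where j: "\<And>i. i \<in> ?I \<Longrightarrow> j i \<le> e ! i" "sum j ?I = m"
      using sum_bounded_decomposition [of ?I m "\<lambda>i. e ! i"] m(1) sum_e by auto
    have "\<exists>f. f \<in> iso (?Z i) (?Z i) \<and> card (fixed_points (?Z i) f) = p ^ j i" if "i \<in> ?I" for i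
      using cyclic_prime_power_iso_fixed_points [OF assms(1,2) j(1) [OF that]] by metis
    then obtain f where f: "\<And>i. i \<in> ?I \<Longrightarrow> f i \<in> iso (?Z i) (?Z i)"
        "\<And>i. i \<in> ?I \<Longrightarrow> card (fixed_points (?Z i) (f i)) = p ^ j i"
      by metis
    obtain \<psi> where \<psi>: "\<psi> \<in> auto ?S"
        "card (fixed_points ?S \<psi>) = (\<Prod>i\<in>?I. card (fixed_points (?Z i) (f i)))"
      using sum_group_auto [of ?I ?Z f] f(1) by auto
    obtain \<phi> where \<phi>: "\<phi> \<in> auto P" "card (fixed_points P \<phi>) = card (fixed_points ?S \<psi>)"
      using P.auto_transport [OF h \<psi>(1)] .
    have "card (fixed_points P \<phi>) = p ^ m"
      using \<phi>(2) \<psi>(2) f(2) by (simp add: power_sum flip: j(2))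
    then show "r \<in> reidemeister_spectrum P"
      using R [OF \<phi>(1)] \<phi>(1) m(2) by (force simp: reidemeister_spectrum_def)
  qed
qed

end
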